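(* Let the kernel $K_{\Delta t}(x,y)$ and its integral operator $$(L_{\Delta t}u)(x)=\int_{\mathbb{R}^r}K_{\Delta t}(x,y)\,u(y)\,\mathrm{d}y$$ admit the expansion $$(L_{\Delta t}u)(x)=u(x)+\Delta t\,\mathcal{L}^*u(x)+C\,(\Delta t)^{3/2}+O(\Delta t^2)\qquad(\Delta t\to0)$$ with $C\neq0$ (independent of $\Delta t$). Define the multi-time-scale operator $$(L^{(2)}_{\Delta t}u)(x)=\alpha\,L_{\Delta t}u(x)+\beta\,L_{\Delta t/2}u(x)+\gamma\,u(x),$$ with coefficients $$\alpha=-\sqrt2-1,\qquad \beta=4+2\sqrt2,\qquad \gamma=-2-\sqrt2 .$$ Then, as $\Delta t\to0$, $$\frac{(L^{(2)}_{\Delta t}u)(x)-u(x)}{\Delta t}=\mathcal{L}^*u(x)+O(\Delta t).$$ Consequently, the corresponding kernel $$K^{(2)}_{\Delta t}(x,y)=\alpha\,K_{\Delta t}(x,y)+\beta\,K_{\Delta t/2}(x,y)+\gamma\,\delta(x-y)$$ (i.e. the kernel of $L^{(2)}_{\Delta t}$) approximates the adjoint Kolmogorov operator $\mathcal{L}^*$ to second order.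
   Context: $f:\mathbb{R}^r\to\mathbb{R}^r$ is the drift, and the adjoint Kolmogorov operator is $\mathcal{L}^*u(x)=\tfrac12\Delta u(x)-\nabla\cdot(f(x)u(x))$. The test function $u$ is sufficiently smooth, and $\delta$ is the Dirac delta, $u(x)=\int\delta(x-y)u(y)\,\mathrm{d}y$. "Second order" means that the local truncation error of $\mathcal{L}^*$, in the sense of the displayed quotient, is $O(\Delta t)$, equivalently $(L^{(2)}_{\Delta t}u)(x)=u(x)+\Delta t\,\mathcal{L}^*u(x)+O(\Delta t^2)$. The kernel the paper has in mind is the first-order kernel $$K_{\Delta t}(x,y)=\frac{1}{(2\pi\Delta t)^{r/2}}\exp\Bigl(-\tfrac{\|x-y\|^2}{2\Delta t}-(y-x)\cdot f(x)-\tfrac{\Delta t}{2}\bigl(2\nabla\cdot f(x)+\|f(x)\|^2\bigr)\Bigr).$$ *)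

theory Defs
  imports "HOL-Analysis.Analysis" "HOL-Library.Landau_Symbols" "HOL-Probability.Giry_Monad"
begin

definition grad :: "(real ^ 'r \<Rightarrow> real) \<Rightarrow> real ^ 'r \<Rightarrow> real ^ 'r::finite" where
  "grad u x = (\<chi> i. frechet_derivative u (at x) (axis i 1))"

definition divergence :: "(real ^ 'r \<Rightarrow> real ^ 'r) \<Rightarrow> real ^ 'r::finite \<Rightarrow> real" where
  "divergence F x = (\<Sum>i\<in>UNIV. frechet_derivative F (at x) (axis i 1) $ i)"

definition laplacian :: "(real ^ 'r \<Rightarrow> real) \<Rightarrow> real ^ 'r::finite \<Rightarrow> real" where
  "laplacian u x = divergence (grad u) x"

definition adjoint_kolmogorov ::
  "(real ^ 'r \<Rightarrow> real ^ 'r) \<Rightarrow> (real ^ 'r \<Rightarrow> real) \<Rightarrow> real ^ 'r::finite \<Rightarrow> real" where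
  "adjoint_kolmogorov f u x = 1/2 * laplacian u x - divergence (\<lambda>y. u y *\<^sub>R f y) x"

text \<open>Twice continuously differentiable on the whole space: the weakest standard smoothness under
  which the adjoint Kolmogorov operator acts classically on \<open>u\<close>.\<close>

definition C2 :: "(real ^ 'r::finite \<Rightarrow> real) \<Rightarrow> bool" where
  "C2 u \<longleftrightarrow> u differentiable_on UNIV \<and> grad u differentiable_on UNIV \<and>
     (\<forall>i. continuous_on UNIV (\<lambda>x. frechet_derivative (grad u) (at x) (axis i 1)))"

definition integral_op ::
  "(real \<Rightarrow> real ^ 'r \<Rightarrow> real ^ 'r \<Rightarrow> real) \<Rightarrow> real \<Rightarrow> (real ^ 'r \<Rightarrow> real) \<Rightarrow> real ^ 'r::finite \<Rightarrow> real" where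
  "integral_op K dt u x = (\<integral>y. K dt x y * u y \<partial>lborel)"

definition multiscale_op ::
  "real \<Rightarrow> real \<Rightarrow> real \<Rightarrow> (real \<Rightarrow> real ^ 'r \<Rightarrow> real ^ 'r \<Rightarrow> real) \<Rightarrow>
   real \<Rightarrow> (real ^ 'r \<Rightarrow> real) \<Rightarrow> real ^ 'r::finite \<Rightarrow> real" where
  "multiscale_op \<alpha> \<beta> \<gamma> K dt u x =
     \<alpha> * integral_op K dt u x + \<beta> * integral_op K (dt/2) u x + \<gamma> * u x"

text \<open>A kernel containing a Dirac delta is not a function of \<open>y\<close>. For fixed \<open>x\<close> it is a generalized
  function of \<open>y\<close>, represented by its pairing with test functions. An ordinary function \<open>k\<close> of \<open>y\<close>
  pairs by integration against Lebesgue measure, and \<open>\<delta>(x - y)\<close> by integration against the Dirac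
  measure at \<open>x\<close>.\<close>

type_synonym 'a gen_fun = "('a \<Rightarrow> real) \<Rightarrow> real"

definition regular_gen_fun :: "(real ^ 'r \<Rightarrow> real) \<Rightarrow> (real ^ 'r::finite) gen_fun" where
  "regular_gen_fun k = (\<lambda>u. \<integral>y. k y * u y \<partial>lborel)"

definition dirac_delta :: "real ^ 'r \<Rightarrow> (real ^ 'r::finite) gen_fun" where
  "dirac_delta x = (\<lambda>u. \<integral>y. u y \<partial>return borel x)"

definition multiscale_kernel ::
  "real \<Rightarrow> real \<Rightarrow> real \<Rightarrow> (real \<Rightarrow> real ^ 'r \<Rightarrow> real ^ 'r \<Rightarrow> real) \<Rightarrow>
   real \<Rightarrow> real ^ 'r \<Rightarrow> (real ^ 'r::finite) gen_fun" where
  "multiscale_kernel \<alpha> \<beta> \<gamma> K dt x =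
     (\<lambda>u. regular_gen_fun (\<lambda>y. \<alpha> * K dt x y + \<beta> * K (dt/2) x y) u + \<gamma> * dirac_delta x u)"

definition gen_kernel_op ::
  "(real \<Rightarrow> real ^ 'r \<Rightarrow> (real ^ 'r) gen_fun) \<Rightarrow>
   real \<Rightarrow> (real ^ 'r \<Rightarrow> real) \<Rightarrow> real ^ 'r::finite \<Rightarrow> real" where
  "gen_kernel_op k dt u x = k dt x u"

text \<open>Second order refers to the local expansion \<open>u + dt * G u + O(dt^2)\<close>, that is, to an error
  \<open>O(dt)\<close> in the difference quotient.\<close>

definition second_order_at ::
  "(real \<Rightarrow> ('a \<Rightarrow> real) \<Rightarrow> 'a \<Rightarrow> real) \<Rightarrow> (('a \<Rightarrow> real) \<Rightarrow> 'a \<Rightarrow> real) \<Rightarrow>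
   ('a \<Rightarrow> real) \<Rightarrow> 'a \<Rightarrow> bool" where
  "second_order_at A G u x \<longleftrightarrow>
     (\<lambda>dt. (A dt u x - u x) / dt - G u x) \<in> O[at_right 0](\<lambda>dt. dt)"

end

theory Submission
  imports Defs
begin

text \<open>The operator combines two step sizes in the manner of Richardson extrapolation. Let
  \<open>I h = a + h * g + C * h powr (3/2) + E h\<close> with \<open>E h = O(h\<^sup>2)\<close>. Substituting \<open>h\<close> and \<open>h/2\<close> into
  \<open>\<alpha> * I h + \<beta> * I (h/2) + \<gamma> * a\<close> multiplies the coefficients of \<open>1\<close>, \<open>h\<close> and \<open>h powr (3/2)\<close> so that
  the value \<open>a\<close> is kept when \<open>\<alpha> + \<beta> + \<gamma> = 1\<close>, the slope \<open>g\<close> is kept when \<open>\<alpha> + \<beta>/2 = 1\<close>, and the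
  half-integer term vanishes when \<open>\<alpha> + \<beta> * (1/2) powr (3/2) = 0\<close>. The stated coefficients are the
  unique solution of these three linear equations. What remains is \<open>\<alpha> * E h + \<beta> * E (h/2)\<close>, which is
  \<open>O(h\<^sup>2)\<close>, so that division by \<open>h\<close> gives the rate (lemma \<open>extrapolation_second_order\<close>).

  The kernel with the Dirac delta acts as the multi-time-scale operator because the integral is
  linear, once the products of \<open>u\<close> with the kernels for \<open>dt\<close> and \<open>dt/2\<close> are both integrable, and
  because \<open>u\<close>, being continuous, is Borel measurable, so that integrating it against the Dirac
  measure returns its value at the point (lemma \<open>gen_kernel_op_multiscale_kernel\<close>).\<close>

lemma filterlim_half_at_right_0: "filterlim (\<lambda>h::real. h / 2) (at_right 0) (at_right 0)"
  unfolding filterlim_at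
  by (auto intro!: tendsto_eq_intros simp: eventually_at_filter)

lemma extrapolation_second_order:
  fixes I :: "real \<Rightarrow> real" and a g C \<alpha> \<beta> \<gamma> :: real
  assumes expansion: "(\<lambda>h. I h - (a + h * g + C * h powr (3/2))) \<in> O[at_right 0](\<lambda>h. h\<^sup>2)"
    and const: "\<alpha> + \<beta> + \<gamma> = 1"
    and linear: "\<alpha> + \<beta> / 2 = 1"
    and half_integer: "\<alpha> + \<beta> * (1/2) powr (3/2) = 0"
  shows "(\<lambda>h. (\<alpha> * I h + \<beta> * I (h/2) + \<gamma> * a - a) / h - g) \<in> O[at_right 0](\<lambda>h. h)"
proof -
  define E where "E h = I h - (a + h * g + C * h powr (3/2))" for h
  have E: "E \<in> O[at_right 0](\<lambda>h. h\<^sup>2)"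
    using expansion by (simp add: E_def [abs_def])
  have "(\<lambda>h. E (h/2)) \<in> O[at_right 0](\<lambda>h. (h/2)\<^sup>2)"
    using landau_o.big.compose[OF E filterlim_half_at_right_0] .
  then have E_half: "(\<lambda>h. E (h/2)) \<in> O[at_right 0](\<lambda>h. h\<^sup>2)"
    by (simp add: power_divide)
  have "(\<lambda>h. \<alpha> * E h + \<beta> * E (h/2)) \<in> O[at_right 0](\<lambda>h. h\<^sup>2)"
    using E E_half by (intro sum_in_bigo) auto
  moreover have "eventually (\<lambda>h::real. h \<noteq> 0) (at_right 0)"
    by (simp add: eventually_at_filter)
  ultimately have "(\<lambda>h. (\<alpha> * E h + \<beta> * E (h/2)) / h) \<in> O[at_right 0](\<lambda>h. h\<^sup>2 / h)"
    by (rule landau_o.big.divide_right[rotated])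
  also have "(\<lambda>h::real. h\<^sup>2 / h) = (\<lambda>h. h)"
    by (simp add: power2_eq_square)
  finally have rate: "(\<lambda>h. (\<alpha> * E h + \<beta> * E (h/2)) / h) \<in> O[at_right 0](\<lambda>h. h)" .
  have "(\<alpha> * I h + \<beta> * I (h/2) + \<gamma> * a - a) / h - g = (\<alpha> * E h + \<beta> * E (h/2)) / h"
    if "h > 0" for h
  proof -
    have "(h/2) powr (3/2) = (1/2) powr (3/2) * h powr (3/2)"
      using powr_mult[of "1/2" h "3/2"] that by simp
    then have "\<alpha> * I h + \<beta> * I (h/2) + \<gamma> * a
        = \<alpha> * E h + \<beta> * E (h/2) + (\<alpha> + \<beta> + \<gamma>) * a + (\<alpha> + \<beta> / 2) * (h * g)
          + (\<alpha> + \<beta> * (1/2) powr (3/2)) * (C * h powr (3/2))"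
      by (simp add: E_def algebra_simps)
    also have "\<dots> = \<alpha> * E h + \<beta> * E (h/2) + a + h * g"
      by (simp only: const linear half_integer)
    finally show ?thesis
      using that by (simp add: field_simps)
  qed
  then have "eventually (\<lambda>h. (\<alpha> * E h + \<beta> * E (h/2)) / h
      = (\<alpha> * I h + \<beta> * I (h/2) + \<gamma> * a - a) / h - g) (at_right 0)"
    using eventually_at_right_less[of "0::real"] by (auto elim: eventually_mono)
  from landau_o.big.in_cong[OF this] rate show ?thesis
    by simp
qed

lemma C2_borel_measurable: "C2 u \<Longrightarrow> u \<in> borel_measurable borel"
  unfolding C2_def
  by (intro borel_measurable_continuous_onI differentiable_imp_continuous_on) simp

lemma gen_kernel_op_multiscale_kernel:
  assumes "u \<in> borel_measurable borel"
    and int: "integrable lborel (\<lambda>y. K dt x y * u y)"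
    and int_half: "integrable lborel (\<lambda>y. K (dt/2) x y * u y)"
  shows "gen_kernel_op (multiscale_kernel \<alpha> \<beta> \<gamma> K) dt u x = multiscale_op \<alpha> \<beta> \<gamma> K dt u x"
proof -
  have "dirac_delta x u = u x"
    unfolding dirac_delta_def using assms(1) by (intro integral_return) auto
  moreover have "regular_gen_fun (\<lambda>y. \<alpha> * K dt x y + \<beta> * K (dt/2) x y) u
      = (\<integral>y. \<alpha> * (K dt x y * u y) + \<beta> * (K (dt/2) x y * u y) \<partial>lborel)"
    unfolding regular_gen_fun_def by (simp add: algebra_simps)
  ultimately show ?thesis
    using int int_half
    by (simp add: gen_kernel_op_def multiscale_kernel_def multiscale_op_def integral_op_def)
qed

lemma half_powr_three_halves: "(1/2::real) powr (3/2) = 1 / (2 * sqrt 2)"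
proof -
  have "(1/2::real) powr (3/2) = (1/2) powr 1 * (1/2) powr (1/2)"
    by (simp only: powr_add[symmetric]) simp
  then show ?thesis
    by (simp add: powr_half_sqrt real_sqrt_divide)
qed

theorem theorem4p3:
  fixes f :: "real ^ 'r \<Rightarrow> real ^ 'r::finite"
    and K :: "real \<Rightarrow> real ^ 'r \<Rightarrow> real ^ 'r \<Rightarrow> real"
    and u :: "real ^ 'r \<Rightarrow> real"
    and x :: "real ^ 'r"
    and C \<alpha> \<beta> \<gamma> :: real
  assumes f: "f differentiable_on UNIV"
    and u: "C2 u"
    and integrable: "\<forall>\<^sub>F dt in at_right 0. integrable lborel (\<lambda>y. K dt x y * u y)"
    and expansion: "(\<lambda>dt. integral_op K dt u x -
          (u x + dt * adjoint_kolmogorov f u x + C * dt powr (3/2))) \<in> O[at_right 0](\<lambda>dt. dt\<^sup>2)"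
    and C: "C \<noteq> 0"
    and coeffs: "\<alpha> = - sqrt 2 - 1" "\<beta> = 4 + 2 * sqrt 2" "\<gamma> = - 2 - sqrt 2"
  shows "(\<lambda>dt. (multiscale_op \<alpha> \<beta> \<gamma> K dt u x - u x) / dt - adjoint_kolmogorov f u x)
            \<in> O[at_right 0](\<lambda>dt. dt) \<and>
         (\<forall>\<^sub>F dt in at_right 0.
            gen_kernel_op (multiscale_kernel \<alpha> \<beta> \<gamma> K) dt u x = multiscale_op \<alpha> \<beta> \<gamma> K dt u x) \<and>
         second_order_at (gen_kernel_op (multiscale_kernel \<alpha> \<beta> \<gamma> K)) (adjoint_kolmogorov f) u x"
proof -
  have const: "\<alpha> + \<beta> + \<gamma> = 1" and linear: "\<alpha> + \<beta> / 2 = 1"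
    unfolding coeffs by (simp_all add: field_simps)
  have half_integer: "\<alpha> + \<beta> * (1/2) powr (3/2) = 0"
    unfolding coeffs half_powr_three_halves by (simp add: field_simps)
  have rate: "(\<lambda>dt. (multiscale_op \<alpha> \<beta> \<gamma> K dt u x - u x) / dt - adjoint_kolmogorov f u x)
      \<in> O[at_right 0](\<lambda>dt. dt)"
    unfolding multiscale_op_def
    by (rule extrapolation_second_order[OF expansion const linear half_integer])
  have "\<forall>\<^sub>F dt in at_right 0. integrable lborel (\<lambda>y. K (dt/2) x y * u y)"
    using eventually_compose_filterlim[OF integrable filterlim_half_at_right_0] .
  with integrable have kernel: "\<forall>\<^sub>F dt in at_right 0.
      gen_kernel_op (multiscale_kernel \<alpha> \<beta> \<gamma> K) dt u x = multiscale_op \<alpha> \<beta> \<gamma> K dt u x"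
    by eventually_elim (rule gen_kernel_op_multiscale_kernel[OF C2_borel_measurable[OF u]])
  then have "\<forall>\<^sub>F dt in at_right 0.
      (multiscale_op \<alpha> \<beta> \<gamma> K dt u x - u x) / dt - adjoint_kolmogorov f u x
      = (gen_kernel_op (multiscale_kernel \<alpha> \<beta> \<gamma> K) dt u x - u x) / dt - adjoint_kolmogorov f u x"
    by eventually_elim simp
  then have "second_order_at (gen_kernel_op (multiscale_kernel \<alpha> \<beta> \<gamma> K)) (adjoint_kolmogorov f) u x"
    unfolding second_order_at_def
    by (rule landau_o.big.in_cong[THEN iffD1]) (rule rate)
  with rate kernel show ?thesis
    by blast
qed

end
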